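(* Let $a,b\geq 0$ be real numbers and let $c=(a+b+1)/2$. If $$2a+1\geq b\geq \frac{a-1}{2}\geq -\frac{b}{2},$$ then $$(x^c+y^c+z^c)^2 \geq (x+y+z)(x^ay^b+y^az^b+z^ax^b)$$ for all $x,y,z\geq 0$. The equality occurs if and only if $x=y=z$.
   Context: Here $x,y,z$ are real numbers, and powers are real powers of nonnegative real numbers.
   Formalization: The equality clause is asserted only for (a,b) other than (1,0) and (0,1): at these two points c=1 and both sides equal (x+y+z)^2 for all x,y,z, so "only if x=y=z" fails; the inequality is still claimed there. The convention 0^0=1 is used. *)

theory Defs
  imports Complex_Main
begin

(* Real power of a nonnegative real base.  It agrees with powr except at 0 powr 0, which is 0 in
   the library; here the zeroth power is the constant 1, as is usual for real powers. *)
definition rpow :: "real \<Rightarrow> real \<Rightarrow> real" where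
  "rpow x p = (if p = 0 then 1 else x powr p)"

end

theory Submission
  imports Defs
begin

text \<open>
  Fix \<open>c\<close> and put \<open>m = 2 (c - 1) / 3\<close>.  On the line \<open>a + b = 2 c - 1\<close> the hypotheses say exactly that
  \<open>(a, b)\<close> lies on the segment between \<open>(m, 2 m + 1)\<close> and \<open>(2 m + 1, m)\<close>.  The left-hand side of the
  inequality depends only on \<open>c\<close>, while each \<open>x\<^sup>a y\<^sup>b\<close> is convex along the segment.  So it
  suffices to treat the two endpoints, and these are interchanged by reversing the cyclic order of the
  variables.

  At the endpoint \<open>(m, 2 m + 1)\<close> the product expands into the cyclic sums of the three monomials
  \<open>x\<^sup>m\<^sup>+\<^sup>1 y\<^sup>2\<^sup>m\<^sup>+\<^sup>1\<close>, \<open>x\<^sup>m y\<^sup>2\<^sup>m\<^sup>+\<^sup>2\<close> and \<open>x\<^sup>m y\<^sup>2\<^sup>m\<^sup>+\<^sup>1 z\<close>, all of degree \<open>2 c\<close> and all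
  with \<open>y\<close>-exponent at least \<open>c\<close>.  Taking out a factor \<open>Y = y\<^sup>c\<close>, weighted AM-GM in
  \<open>X = x\<^sup>c\<close>, \<open>Y\<close> and \<open>Z = z\<^sup>c\<close> bounds each of them by a combination of \<open>X Y\<close>, \<open>Y\<^sup>2\<close> and \<open>Y Z\<close>
  (\<open>rpow_monomial_le\<close>).  The coefficients of the three bounds add up so that the cyclic sum is exactly
  \<open>(X + Y + Z)\<^sup>2\<close>, which is \<open>endpoint_inequality\<close>.

  For the equality case, if \<open>c > 1\<close> then already the bounds for \<open>x\<^sup>m\<^sup>+\<^sup>1 y\<^sup>2\<^sup>m\<^sup>+\<^sup>1\<close> and its cyclic images
  force \<open>x = y = z\<close>.  If \<open>c = 1\<close>, the endpoints are \<open>(0, 1)\<close> and \<open>(1, 0)\<close>, where both sides agree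
  identically; between them, strictness comes from \<open>x\<^sup>a y\<^sup>b < a x + b y\<close> for \<open>x \<noteq> y\<close>.
\<close>

section \<open>Real powers and weighted AM-GM\<close>

lemma rpow_nonneg: "rpow x p \<ge> 0"
  by (simp add: rpow_def)

lemma rpow_0_right [simp]: "rpow x 0 = 1"
  by (simp add: rpow_def)

lemma rpow_1_right: "x \<ge> 0 \<Longrightarrow> rpow x 1 = x"
  by (simp add: rpow_def)

lemma rpow_add:
  assumes "p \<ge> 0" "q \<ge> 0"
  shows "rpow x (p + q) = rpow x p * rpow x q"
  using assms by (auto simp: rpow_def powr_add)

lemma rpow_rpow:
  assumes "c > 0"
  shows "rpow (rpow x c) (p / c) = rpow x p"
  using assms by (auto simp: rpow_def powr_powr)

lemma rpow_eq_iff: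
  assumes "x \<ge> 0" "y \<ge> 0" "c > 0"
  shows "rpow x c = rpow y c \<longleftrightarrow> x = y"
proof -
  have "rpow (rpow t c) (1 / c) = t" if "t \<ge> 0" for t
    using that assms by (simp add: rpow_rpow rpow_1_right)
  then show ?thesis
    using assms by metis
qed

text \<open>
  This is \<open>ln (u / m) \<le> u / m - 1\<close> raised to the power \<open>p\<close>.  The exponential form also covers
  \<open>u = 0\<close>, and multiplying several such bounds with \<open>m\<close> the weighted mean gives AM-GM.
\<close>
lemma rpow_le_exp:
  assumes "u \<ge> 0" "m > 0" "p \<ge> 0"
  shows "rpow u p \<le> m powr p * exp (p * (u / m - 1))"
    and "p > 0 \<Longrightarrow> u \<noteq> m \<Longrightarrow> rpow u p < m powr p * exp (p * (u / m - 1))"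
proof -
  have split: "rpow u p = m powr p * exp (p * ln (u / m))" if "u > 0"
    using that assms by (auto simp: rpow_def powr_def ln_div algebra_simps simp flip: exp_add)
  have le: "ln (u / m) \<le> u / m - 1" if "u > 0"
    using that assms by (intro ln_le_minus_one) simp
  show "rpow u p \<le> m powr p * exp (p * (u / m - 1))"
  proof (cases "u = 0")
    case True
    then show ?thesis
      using assms by (auto simp: rpow_def)
  next
    case False
    then show ?thesis
      using assms split le by (simp add: mult_left_mono)
  qed
  show "rpow u p < m powr p * exp (p * (u / m - 1))" if "p > 0" "u \<noteq> m"
  proof (cases "u = 0")
    case True
    then show ?thesis
      using that assms by (auto simp: rpow_def)
  next
    case False
    then have "u > 0" using assms by simp
    moreover have "ln (u / m) \<noteq> u / m - 1"
      using ln_eq_minus_one[of "u / m"] \<open>u > 0\<close> that assms by auto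
    ultimately show ?thesis
      using that assms split le by simp
  qed
qed

lemma weighted_am_gm3:
  assumes nn: "u \<ge> 0" "v \<ge> 0" "w \<ge> 0" "p \<ge> 0" "q \<ge> 0" "r \<ge> 0"
    and sum: "p + q + r = 1"
  shows "rpow u p * rpow v q * rpow w r \<le> p * u + q * v + r * w"
    and "p > 0 \<Longrightarrow> q > 0 \<Longrightarrow> u \<noteq> v \<Longrightarrow>
      rpow u p * rpow v q * rpow w r < p * u + q * v + r * w"
proof -
  define m where "m = p * u + q * v + r * w"
  define B where "B t s = m powr s * exp (s * (t / m - 1))" for t s
  have m0: "m \<ge> 0" "p * u \<le> m" "q * v \<le> m" "r * w \<le> m"
    unfolding m_def using nn by simp_all
  have B_prod: "B u p * B v q * B w r = m" if "m > 0"
  proof -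
    have "B u p * B v q * B w r
        = m powr (p + q + r) * exp (p * (u / m - 1) + q * (v / m - 1) + r * (w / m - 1))"
      by (simp add: B_def powr_add exp_add)
    also have "p * (u / m - 1) + q * (v / m - 1) + r * (w / m - 1)
        = (p * u + q * v + r * w) / m - (p + q + r)"
      by (simp add: algebra_simps add_divide_distrib)
    finally show ?thesis
      using that sum by (simp flip: m_def)
  qed
  have B_pos: "B t s > 0" if "m > 0" for t s
    using that by (simp add: B_def)
  have le: "rpow u p \<le> B u p" "rpow v q \<le> B v q" "rpow w r \<le> B w r" if "m > 0"
    unfolding B_def using that nn by (simp_all add: rpow_le_exp)
  show "rpow u p * rpow v q * rpow w r \<le> p * u + q * v + r * w"
  proof (cases "m > 0")
    case True
    have "rpow u p * rpow v q * rpow w r \<le> B u p * B v q * B w r"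
      using le[OF True] B_pos[OF True] by (intro mult_mono) (auto simp: rpow_nonneg less_imp_le)
    then show ?thesis
      using B_prod[OF True] by (simp add: m_def)
  next
    case False
    \<comment> \<open>The mean vanishes, so a variable with positive weight is zero.\<close>
    moreover have "p * u \<ge> 0" "q * v \<ge> 0" "r * w \<ge> 0"
      using nn by simp_all
    ultimately have "p * u = 0" "q * v = 0" "r * w = 0"
      using m0 by linarith+
    moreover have "p \<noteq> 0 \<or> q \<noteq> 0 \<or> r \<noteq> 0"
      using sum by auto
    ultimately have "rpow u p * rpow v q * rpow w r = 0"
      by (auto simp: rpow_def)
    then show ?thesis
      using m0(1) unfolding m_def by linarith
  qed
  show "rpow u p * rpow v q * rpow w r < p * u + q * v + r * w"
    if pq: "p > 0" "q > 0" and "u \<noteq> v"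
  proof -
    have "p * u > 0 \<or> q * v > 0"
      using pq nn \<open>u \<noteq> v\<close> by (auto simp: zero_less_mult_iff)
    then have m: "m > 0"
      using m0 by linarith
    have uv: "rpow u p * rpow v q < B u p * B v q"
    proof (cases "u = m")
      case True
      then have "rpow v q < B v q"
        unfolding B_def using \<open>u \<noteq> v\<close> nn m pq by (auto intro: rpow_le_exp)
      then have "B u p * rpow v q < B u p * B v q"
        using B_pos[OF m] by simp
      moreover have "rpow u p * rpow v q \<le> B u p * rpow v q"
        using le[OF m] by (simp add: mult_right_mono rpow_nonneg)
      ultimately show ?thesis by simp
    next
      case False
      then have "rpow u p < B u p"
        unfolding B_def using nn m pq by (auto intro: rpow_le_exp)
      then have "rpow u p * B v q < B u p * B v q"
        using B_pos[OF m] by simp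
      moreover have "rpow u p * rpow v q \<le> rpow u p * B v q"
        using le[OF m] by (simp add: mult_left_mono rpow_nonneg)
      ultimately show ?thesis by simp
    qed
    have "rpow u p * rpow v q * rpow w r \<le> rpow u p * rpow v q * B w r"
      using le[OF m] by (simp add: mult_left_mono rpow_nonneg)
    also have "\<dots> < B u p * B v q * B w r"
      using uv B_pos[OF m] by simp
    finally show ?thesis
      using B_prod[OF m] by (simp add: m_def)
  qed
qed

lemma weighted_am_gm2:
  assumes "u \<ge> 0" "v \<ge> 0" "p \<ge> 0" "q \<ge> 0" "p + q = 1"
  shows "rpow u p * rpow v q \<le> p * u + q * v"
    and "p > 0 \<Longrightarrow> q > 0 \<Longrightarrow> u \<noteq> v \<Longrightarrow> rpow u p * rpow v q < p * u + q * v"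
  using weighted_am_gm3[of u v 0 p q 0] assms by simp_all

section \<open>The endpoints of the exponent segment\<close>

text \<open>
  Because \<open>q \<ge> c\<close>, a factor \<open>y\<^sup>c\<close> can be taken out; the rest has degree \<open>c\<close> and is a weighted
  geometric mean of \<open>x\<^sup>c\<close>, \<open>y\<^sup>c\<close> and \<open>z\<^sup>c\<close>.
\<close>
lemma rpow_monomial_le:
  assumes xyz: "x \<ge> 0" "y \<ge> 0" "z \<ge> 0" and c: "c > 0"
    and pqr: "p \<ge> 0" "q \<ge> c" "r \<ge> 0" "p + q + r = 2 * c"
  defines "M \<equiv> rpow x p * rpow y q * rpow z r"
    and "U \<equiv> rpow y c * (p / c * rpow x c + (q - c) / c * rpow y c + r / c * rpow z c)"
  shows "M \<le> U"
    and "p > 0 \<Longrightarrow> q > c \<Longrightarrow> y \<noteq> 0 \<Longrightarrow> x \<noteq> y \<Longrightarrow> M < U"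
proof -
  let ?G = "rpow (rpow x c) (p / c) * rpow (rpow y c) ((q - c) / c) * rpow (rpow z c) (r / c)"
  let ?A = "p / c * rpow x c + (q - c) / c * rpow y c + r / c * rpow z c"
  have "rpow y q = rpow y c * rpow y (q - c)"
    using rpow_add[of c "q - c" y] pqr c by simp
  then have M: "M = rpow y c * ?G"
    by (simp add: M_def rpow_rpow[OF c])
  have wsum: "p / c + (q - c) / c + r / c = 1"
    using c pqr by (simp add: field_simps)
  show "M \<le> U"
    unfolding M U_def using c pqr wsum
    by (intro mult_left_mono weighted_am_gm3) (auto simp: rpow_nonneg)
  show "M < U" if "p > 0" "q > c" "y \<noteq> 0" "x \<noteq> y"
  proof -
    have "?G < ?A"
      using that c pqr xyz wsum by (intro weighted_am_gm3) (auto simp: rpow_nonneg rpow_eq_iff)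
    moreover have "rpow y c > 0"
      using that xyz by (simp add: rpow_def)
    ultimately show ?thesis
      unfolding M U_def by simp
  qed
qed

text \<open>
  The bounds for the three monomials use \<open>y\<^sup>2\<^sup>c\<close> with weights \<open>(q - c) / c\<close>, where the
  \<open>y\<close>-exponents \<open>q\<close> exceed \<open>c\<close> by \<open>m / 2\<close>, \<open>m / 2 + 1\<close> and \<open>m / 2\<close>.  These excesses add up to
  \<open>c\<close>, so \<open>y\<^sup>2\<^sup>c\<close> gets the total weight 1 that it has in the square, and nothing is left over.
\<close>
lemma endpoint_inequality:
  fixes x y z m :: real
  assumes xyz: "x \<ge> 0" "y \<ge> 0" "z \<ge> 0" and m: "m \<ge> 0" and c: "c = (3 * m + 2) / 2"
  defines "L \<equiv> (rpow x c + rpow y c + rpow z c)\<^sup>2"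
    and "R \<equiv> (x + y + z) * (rpow x m * rpow y (2 * m + 1) + rpow y m * rpow z (2 * m + 1)
                + rpow z m * rpow x (2 * m + 1))"
  shows "R \<le> L"
    and "m > 0 \<Longrightarrow> \<not> (x = y \<and> y = z) \<Longrightarrow> R < L"
proof -
  have cpos: "c > 0" using m c by simp
  define T1 where "T1 u v = rpow u (m + 1) * rpow v (2 * m + 1)" for u v
  define T2 where "T2 u v = rpow u m * rpow v (2 * m + 2)" for u v
  define T3 where "T3 u v w = rpow u m * rpow v (2 * m + 1) * rpow w 1" for u v w
  define U1 where "U1 u v = rpow v c * ((m + 1) / c * rpow u c + (m / 2) / c * rpow v c)" for u v
  define U2 where "U2 u v = rpow v c * (m / c * rpow u c + (m / 2 + 1) / c * rpow v c)" for u v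
  define U3 where "U3 u v w =
    rpow v c * (m / c * rpow u c + (m / 2) / c * rpow v c + 1 / c * rpow w c)" for u v w
  have bounds: "T1 u v \<le> U1 u v" "T2 u v \<le> U2 u v" "T3 u v w \<le> U3 u v w"
    if "u \<ge> 0" "v \<ge> 0" "w \<ge> 0" for u v w
    using rpow_monomial_le(1)[of u v 0 c "m + 1" "2 * m + 1" 0]
      rpow_monomial_le(1)[of u v 0 c m "2 * m + 2" 0]
      rpow_monomial_le(1)[of u v w c m "2 * m + 1" 1] that m cpos
    by (simp_all add: T1_def T2_def T3_def U1_def U2_def U3_def c field_simps)
  have strict: "T1 u v < U1 u v" if "u \<ge> 0" "v \<ge> 0" "m > 0" "v \<noteq> 0" "u \<noteq> v" for u v
    using rpow_monomial_le(2)[of u v 0 c "m + 1" "2 * m + 1" 0] that m cpos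
    by (simp add: T1_def U1_def c field_simps)
  have expand: "(x + y + z) * (rpow u m * rpow v (2 * m + 1)) = T1 u v + T2 u v + T3 u v w"
    if "u \<ge> 0" "v \<ge> 0" "w \<ge> 0" "u + v + w = x + y + z" for u v w
  proof -
    have "rpow u (m + 1) = rpow u m * u" "rpow v (2 * m + 2) = rpow v (2 * m + 1) * v"
      using rpow_add[of m 1 u] rpow_add[of "2 * m + 1" 1 v] m that
      by (simp_all add: rpow_1_right add.commute)
    then show ?thesis
      using that(1-3) unfolding that(4)[symmetric]
      by (simp add: T1_def T2_def T3_def rpow_1_right algebra_simps)
  qed
  have R: "R = (T1 x y + T1 y z + T1 z x) + (T2 x y + T2 y z + T2 z x)
      + (T3 x y z + T3 y z x + T3 z x y)"
    unfolding R_def distrib_left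
    using expand[of x y z] expand[of y z x] expand[of z x y] xyz by (simp add: algebra_simps)
  have U: "U1 u v + U2 u v + U3 u v w = rpow v c * ((3 * m + 1) / c * rpow u c + rpow v c + 1 / c * rpow w c)"
    for u v w
  proof -
    have "U1 u v + U2 u v + U3 u v w =
        rpow v c * ((3 * m + 1) / c * rpow u c + ((3 * m + 2) / 2) / c * rpow v c + 1 / c * rpow w c)"
      using cpos unfolding U1_def U2_def U3_def by (simp add: field_simps)
    then show ?thesis
      using cpos by (simp flip: c)
  qed
  have L: "L = (U1 x y + U1 y z + U1 z x) + (U2 x y + U2 y z + U2 z x)
      + (U3 x y z + U3 y z x + U3 z x y)"
  proof -
    define k where "k = 1 / c"
    have k: "(3 * m + 1) / c = 2 - k"
      using cpos unfolding k_def by (simp add: field_simps c)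
    show ?thesis
      using U[of x y z, unfolded k, folded k_def] U[of y z x, unfolded k, folded k_def]
        U[of z x y, unfolded k, folded k_def]
      unfolding L_def by (simp add: power2_eq_square algebra_simps)
  qed
  have T1_le: "T1 x y \<le> U1 x y" "T1 y z \<le> U1 y z" "T1 z x \<le> U1 z x"
    using bounds xyz by blast+
  have rest: "R - (T1 x y + T1 y z + T1 z x) \<le> L - (U1 x y + U1 y z + U1 z x)"
    unfolding R L using bounds(2,3)[of x y z] bounds(2,3)[of y z x] bounds(2,3)[of z x y] xyz
    by simp
  show "R \<le> L"
    using T1_le rest by linarith
  show "R < L" if "m > 0" "\<not> (x = y \<and> y = z)"
  proof -
    \<comment> \<open>A nonzero variable equals its cyclic predecessor in the case of equality, so one nonzero
        variable makes all three equal.\<close>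
    have "(y \<noteq> 0 \<and> x \<noteq> y) \<or> (z \<noteq> 0 \<and> y \<noteq> z) \<or> (x \<noteq> 0 \<and> z \<noteq> x)"
      using that by auto
    then have "T1 x y < U1 x y \<or> T1 y z < U1 y z \<or> T1 z x < U1 z x"
      using strict that xyz by blast
    then show ?thesis
      using T1_le rest by linarith
  qed
qed

section \<open>Convexity between the endpoints\<close>

text \<open>
  Between \<open>(m, n)\<close> and \<open>(n, m)\<close> the value of \<open>x\<^sup>a y\<^sup>b\<close> is the weighted geometric mean of its
  values at the two ends, hence at most their weighted arithmetic mean.
\<close>
lemma rpow_mult_le_convex_combination:
  assumes xy: "x \<ge> 0" "y \<ge> 0" and mn: "m \<ge> 0" "n \<ge> 0" and st: "s \<ge> 0" "t \<ge> 0" "s + t = 1"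
  shows "rpow x (s * m + t * n) * rpow y (s * n + t * m)
           \<le> s * (rpow x m * rpow y n) + t * (rpow x n * rpow y m)"
proof -
  have mult: "rpow (rpow u p * rpow v q) s = rpow u (s * p) * rpow v (s * q)"
    if "u \<ge> 0" "v \<ge> 0" for u v p q s
    using that by (auto simp: rpow_def powr_mult powr_powr mult.commute)
  have "rpow x (s * m + t * n) * rpow y (s * n + t * m)
      = rpow (rpow x m * rpow y n) s * rpow (rpow x n * rpow y m) t"
    using assms by (simp add: mult rpow_add)
  also have "\<dots> \<le> s * (rpow x m * rpow y n) + t * (rpow x n * rpow y m)"
    using st by (intro weighted_am_gm2) (auto simp: rpow_nonneg)
  finally show ?thesis .
qed

theorem theorem6:
  fixes a b c x y z :: real
  assumes "a \<ge> 0" and "b \<ge> 0"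
    and "c = (a + b + 1) / 2"
    and "2 * a + 1 \<ge> b" and "b \<ge> (a - 1) / 2" and "(a - 1) / 2 \<ge> - b / 2"
    and "x \<ge> 0" and "y \<ge> 0" and "z \<ge> 0"
  shows "(rpow x c + rpow y c + rpow z c)^2
           \<ge> (x + y + z) * (rpow x a * rpow y b + rpow y a * rpow z b + rpow z a * rpow x b)
       \<and> ((a, b) \<noteq> (1, 0) \<and> (a, b) \<noteq> (0, 1) \<longrightarrow>
           ((rpow x c + rpow y c + rpow z c)^2
             = (x + y + z) * (rpow x a * rpow y b + rpow y a * rpow z b + rpow z a * rpow x b)
            \<longleftrightarrow> x = y \<and> y = z))"
proof -
  define m where "m = 2 * (c - 1) / 3"
  define n where "n = 2 * m + 1"
  define s where "s = (b - m) / (m + 1)"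
  define t where "t = (a - m) / (m + 1)"
  have m0: "m \<ge> 0" and n0: "n \<ge> 0" and c: "c = (3 * m + 2) / 2"
    using assms by (auto simp: m_def n_def field_simps)
  have ab: "a + b = 3 * m + 1"
    using assms(3) c by simp
  have st: "s \<ge> 0" "t \<ge> 0" "s + t = 1"
    using assms(4,5) m0 ab unfolding s_def t_def by (simp_all flip: add_divide_distrib)
  have ab_st: "a = s * m + t * n" "b = s * n + t * m"
  proof -
    have sm: "s * (m + 1) = b - m" and tm: "t * (m + 1) = a - m"
      using m0 by (simp_all add: s_def t_def)
    have "s * m + t * n = (s + t) * m + t * (m + 1)" "s * n + t * m = (s + t) * m + s * (m + 1)"
      by (simp_all add: n_def algebra_simps)
    then show "a = s * m + t * n" "b = s * n + t * m"
      using st sm tm by simp_all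
  qed
  define L where "L = (rpow x c + rpow y c + rpow z c)\<^sup>2"
  define S where "S p q = rpow x p * rpow y q + rpow y p * rpow z q + rpow z p * rpow x q" for p q
  define R where "R p q = (x + y + z) * S p q" for p q
  have pair: "rpow u a * rpow v b \<le> s * (rpow u m * rpow v n) + t * (rpow u n * rpow v m)"
    if "u \<ge> 0" "v \<ge> 0" for u v
    unfolding ab_st using rpow_mult_le_convex_combination that m0 n0 st by blast
  have S_le: "S a b \<le> s * S m n + t * S n m"
    using pair[of x y] pair[of y z] pair[of z x] assms by (simp add: S_def algebra_simps)
  have R_le: "R a b \<le> s * R m n + t * R n m"
    using mult_left_mono[OF S_le, of "x + y + z"] assms by (simp add: R_def algebra_simps)
  have end1: "R m n \<le> L" "m > 0 \<Longrightarrow> \<not> (x = y \<and> y = z) \<Longrightarrow> R m n < L"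
    using endpoint_inequality[of x y z m c, OF assms(7-9) m0 c]
    unfolding R_def S_def L_def n_def by simp_all
  \<comment> \<open>Reversing the cyclic order interchanges the two exponents.\<close>
  have end2: "R n m \<le> L" "m > 0 \<Longrightarrow> \<not> (x = y \<and> y = z) \<Longrightarrow> R n m < L"
    using endpoint_inequality[of z y x m c, OF assms(9,8,7) m0 c]
    unfolding R_def S_def L_def n_def by (auto simp: ac_simps)
  have avg: "s * R m n + t * R n m \<le> L"
    using convex_bound_le[of "R m n" L "R n m" s t] end1 end2 st by simp
  have le: "R a b \<le> L"
    using R_le avg by simp
  have lt: "R a b < L" if ne: "(a, b) \<noteq> (1, 0)" "(a, b) \<noteq> (0, 1)" "\<not> (x = y \<and> y = z)"
  proof (cases "m > 0")
    case True
    then have "s * R m n + t * R n m < L"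
      using convex_bound_lt[of "R m n" L "R n m" s t] end1 end2 st ne by simp
    then show ?thesis using R_le by simp
  next
    case False
    then have m: "m = 0" "n = 1" "c = 1" using m0 by (auto simp: n_def c)
    have apos: "a > 0" "b > 0" "a + b = 1"
      using ne assms(1,2) ab m by auto
    have le: "rpow u a * rpow v b \<le> a * u + b * v" if "u \<ge> 0" "v \<ge> 0" for u v
      using weighted_am_gm2(1) apos that by simp
    have less: "rpow u a * rpow v b < a * u + b * v" if "u \<ge> 0" "v \<ge> 0" "u \<noteq> v" for u v
      using weighted_am_gm2(2) apos that by simp
    have "rpow x a * rpow y b < a * x + b * y \<or> rpow y a * rpow z b < a * y + b * z"
      using less ne assms by blast
    then have "S a b < (a * x + b * y) + (a * y + b * z) + (a * z + b * x)"
      using le[of x y] le[of y z] le[of z x] assms unfolding S_def by linarith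
    also have "\<dots> = (a + b) * (x + y + z)"
      by (simp add: algebra_simps)
    finally have "S a b < x + y + z"
      using apos by simp
    moreover have "x + y + z > 0"
      using ne assms by auto
    ultimately have "R a b < (x + y + z) * (x + y + z)"
      by (simp add: R_def)
    then show ?thesis
      using assms m by (simp add: L_def rpow_1_right power2_eq_square)
  qed
  have eq: "L = R a b" if "x = y" "y = z"
  proof -
    have "rpow z (c + c) = rpow z c * rpow z c"
      using m0 c by (intro rpow_add) auto
    moreover have "rpow z (a + b + 1) = rpow z a * rpow z b * z"
      using rpow_add[of "a + b" 1 z] rpow_add[of a b z] assms by (simp add: rpow_1_right)
    moreover have "c + c = a + b + 1"
      using assms(3) by simp
    ultimately have "rpow z c * rpow z c = rpow z a * rpow z b * z"
      by simp
    then show ?thesis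
      using that by (simp add: L_def R_def S_def power2_eq_square algebra_simps)
  qed
  show ?thesis
    using le lt eq unfolding L_def R_def S_def by (metis order_less_irrefl)
qed

end
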